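(* Let $\boldsymbol{\Omega}_1,\dots,\boldsymbol{\Omega}_n$ be discrete directions in $\mathbb{S}^d$ with $d\in\{1,2\}$, and let $w_1,\dots,w_n>0$ be quadrature weights, such that $$\sum_j w_j=1,\qquad \sum_j w_j\boldsymbol{\Omega}_j=\mathbf{0},\qquad \sum_j w_j\,\boldsymbol{\Omega}_j\otimes\boldsymbol{\Omega}_j=D_c\,I,$$ where $I$ is the identity matrix, $D_c=\frac13$ if the directions are in $\mathbb{S}^2$ and $D_c=\frac12$ if they are in $\mathbb{S}^1$. Let $\sigma>0$ and $\varepsilon\in\,]0,1]$. Then the $S_N$ model $$\partial_t f_i+\frac1\varepsilon\boldsymbol{\Omega}_i\cdot\nabla f_i=-\frac{\sigma}{\varepsilon^2}\Big(f_i-\sum_j w_jf_j\Big),\qquad i=1,\dots,n,$$ in space dimension two (unknowns depending on $(x,y)$ and $t$), can be formulated as $$\partial_t\mathbf{U}+\frac1\varepsilon A_1\partial_x\mathbf{U}+\frac1\varepsilon A_2\partial_y\mathbf{U}=-\frac{\sigma}{\varepsilon^2}R\,\mathbf{U},$$ with $U_j=\sqrt{w_j}\,f_j$ for each $j$ and $R=I_n-\sqrt{\mathbf{w}}\otimes\sqrt{\mathbf{w}}$, where $\sqrt{\mathbf{w}}=(\sqrt{w_1},\dots,\sqrt{w_n})$. This system satisfies the following properties: (i) $\dim\operatorname{Ker}R=1$; (ii) $A_1$ and $A_2$ are diagonal; (iii) $0$ is an eigenvalue of $R$ with multiplicity $1$ and eigenvector $\mathbf{E}_1=(\sqrt{w_1},\dots,\sqrt{w_n})$;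 (iv) $1$ is an eigenvalue of $R$ with multiplicity $n-1$; (v) $R$ is symmetric with real coefficients; (vi) $A_1\mathbf{E}_1=a\,\mathbf{E}_2$ and $A_2\mathbf{E}_1=a\,\mathbf{E}_3$ for a real number $a$ and eigenvectors $\mathbf{E}_2,\mathbf{E}_3$ of $R$ for the eigenvalue $1$ such that $\mathbf{E}_1,\mathbf{E}_2,\mathbf{E}_3$ are orthonormal.
   Context: $f_i$ is the value of the unknown distribution function in the direction $\boldsymbol{\Omega}_i$, $\boldsymbol{\Omega}_i$ has $x$- and $y$-components $\Omega_i^x,\Omega_i^y$, and $\boldsymbol{\Omega}_i\cdot\nabla f_i=\Omega_i^x\partial_xf_i+\Omega_i^y\partial_yf_i$ (when the directions are in $\mathbb{S}^2$ the unknowns do not depend on the third space variable). $A_1,A_2$ are constant $n\times n$ real matrices, $I_n$ is the $n\times n$ identity matrix, and $(\mathbf{a}\otimes\mathbf{b})_{ij}=a_ib_j$. "Can be formulated as" means that $(f_1,\dots,f_n)$ solves the $S_N$ model if and only if $\mathbf{U}=(U_1,\dots,U_n)$ with $U_j=\sqrt{w_j}f_j$ solves the second system. *)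

theory Defs
  imports
    "Jordan_Normal_Form.Char_Poly"
    "Jordan_Normal_Form.Matrix_Kernel"
    Complex_Main
begin

definition outer_prod :: "real vec \<Rightarrow> real vec \<Rightarrow> real mat" where
  "outer_prod a b = mat (dim_vec a) (dim_vec b) (\<lambda>(i, j). a $ i * b $ j)"

(* The sphere S^d in R^(d+1).  Coordinate 0 is the x-component, coordinate 1 the y-component. *)
definition unit_sphere :: "nat \<Rightarrow> real vec set" where
  "unit_sphere d = {v \<in> carrier_vec (d + 1). v \<bullet> v = 1}"

(* Only used for d = 1 and d = 2. *)
definition diffusion_const :: "nat \<Rightarrow> real" where
  "diffusion_const d = (if d = 2 then 1 / 3 else 1 / 2)"

(* n directions Om 0, ..., Om (n - 1) in S^d with positive weights; the values Om i for i \<ge> n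
   are irrelevant. *)
definition sn_quadrature :: "nat \<Rightarrow> nat \<Rightarrow> (nat \<Rightarrow> real vec) \<Rightarrow> real vec \<Rightarrow> bool" where
  "sn_quadrature d n Om w \<longleftrightarrow>
     (\<forall>i<n. Om i \<in> unit_sphere d) \<and>
     w \<in> carrier_vec n \<and> (\<forall>i<n. w $ i > 0) \<and>
     (\<Sum>j<n. w $ j) = 1 \<and>
     vec (d + 1) (\<lambda>k. \<Sum>j<n. w $ j * Om j $ k) = 0\<^sub>v (d + 1) \<and>
     mat (d + 1) (d + 1) (\<lambda>(k, l). \<Sum>j<n. w $ j * outer_prod (Om j) (Om j) $$ (k, l))
       = diffusion_const d \<cdot>\<^sub>m 1\<^sub>m (d + 1)"

(* Solutions are classical: on a set D of points (t, x, y), meant to be open, all first partial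
   derivatives exist and the equations hold pointwise. *)
definition sn_solution ::
  "nat \<Rightarrow> (nat \<Rightarrow> real vec) \<Rightarrow> real vec \<Rightarrow> real \<Rightarrow> real \<Rightarrow> (real \<times> real \<times> real) set \<Rightarrow>
   (nat \<Rightarrow> real \<Rightarrow> real \<Rightarrow> real \<Rightarrow> real) \<Rightarrow> bool" where
  "sn_solution n Om w \<sigma> \<epsilon> D f \<longleftrightarrow>
     (\<forall>t x y. (t, x, y) \<in> D \<longrightarrow>
       (\<forall>i<n. \<exists>ft fx fy.
          ((\<lambda>s. f i s x y) has_real_derivative ft) (at t) \<and>
          ((\<lambda>s. f i t s y) has_real_derivative fx) (at x) \<and>
          ((\<lambda>s. f i t x s) has_real_derivative fy) (at y) \<and>
          ft + 1 / \<epsilon> * (Om i $ 0 * fx + Om i $ 1 * fy)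
            = - (\<sigma> / \<epsilon>\<^sup>2) * (f i t x y - (\<Sum>j<n. w $ j * f j t x y))))"

definition has_vec_deriv :: "nat \<Rightarrow> (real \<Rightarrow> real vec) \<Rightarrow> real vec \<Rightarrow> real \<Rightarrow> bool" where
  "has_vec_deriv n V V' s \<longleftrightarrow>
     V' \<in> carrier_vec n \<and> (\<forall>i<n. ((\<lambda>r. V r $ i) has_real_derivative V' $ i) (at s))"

definition system_solution ::
  "nat \<Rightarrow> real mat \<Rightarrow> real mat \<Rightarrow> real mat \<Rightarrow> real \<Rightarrow> real \<Rightarrow> (real \<times> real \<times> real) set \<Rightarrow>
   (real \<Rightarrow> real \<Rightarrow> real \<Rightarrow> real vec) \<Rightarrow> bool" where
  "system_solution n A1 A2 R \<sigma> \<epsilon> D U \<longleftrightarrow>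
     (\<forall>t x y. (t, x, y) \<in> D \<longrightarrow>
       U t x y \<in> carrier_vec n \<and>
       (\<exists>Ut Ux Uy.
          has_vec_deriv n (\<lambda>s. U s x y) Ut t \<and>
          has_vec_deriv n (\<lambda>s. U t s y) Ux x \<and>
          has_vec_deriv n (\<lambda>s. U t x s) Uy y \<and>
          Ut + (1 / \<epsilon>) \<cdot>\<^sub>v (A1 *\<^sub>v Ux) + (1 / \<epsilon>) \<cdot>\<^sub>v (A2 *\<^sub>v Uy)
            = (- (\<sigma> / \<epsilon>\<^sup>2)) \<cdot>\<^sub>v (R *\<^sub>v U t x y)))"

definition relax_mat :: "nat \<Rightarrow> real vec \<Rightarrow> real mat" where
  "relax_mat n w = 1\<^sub>m n - outer_prod (map_vec sqrt w) (map_vec sqrt w)"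

(* Both readings of the multiplicity, algebraic and geometric, are required. *)
definition eigenvalue_multiplicity :: "real mat \<Rightarrow> real \<Rightarrow> nat \<Rightarrow> bool" where
  "eigenvalue_multiplicity A k m \<longleftrightarrow>
     eigenvalue A k \<and>
     Polynomial.order k (char_poly A) = m \<and>
     kernel_dim (char_matrix A k) = m"

definition orthonormal_list :: "real vec list \<Rightarrow> bool" where
  "orthonormal_list vs \<longleftrightarrow>
     (\<forall>i<length vs. \<forall>j<length vs. vs ! i \<bullet> vs ! j = (if i = j then 1 else 0))"

end

theory Submission
  imports
    Defs
    "Jordan_Normal_Form.Jordan_Normal_Form_Uniqueness"
begin

text \<open>
  Put \<open>s = sqrt w\<close> componentwise. Row \<open>i\<close> of the system is row \<open>i\<close> of the \<open>S\<^sub>N\<close> model multiplied by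
  \<open>s\<^sub>i > 0\<close>: transport acts separately on each direction, so \<open>A\<^sub>1\<close> and \<open>A\<^sub>2\<close> are the diagonal
  matrices of the \<open>x\<close>- and \<open>y\<close>-components of the directions, and \<open>w\<^sub>j f\<^sub>j = s\<^sub>j U\<^sub>j\<close> turns the weighted mean of
  \<open>f\<close> into the inner product of \<open>s\<close> and \<open>U\<close>. Scaling by \<open>s\<^sub>i\<close> can be undone, whence the equivalence
  (lemma \<open>sn_solution_iff_system_solution\<close>).

  The weights have sum 1, so \<open>s\<close> is a unit vector and \<open>R = I - s s\<^sup>T\<close> is the orthogonal projection
  onto the complement of \<open>s\<close>. All the multiplicities are read off from one similarity: the Householder
  reflection that exchanges \<open>s\<close> with \<open>- e\<^sub>0\<close> conjugates \<open>R\<close> to \<open>I - e\<^sub>0 e\<^sub>0\<^sup>T = diag (0, 1, \<dots>, 1)\<close>.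
  This is a Jordan matrix all of whose blocks have size 1, so that algebraic and geometric
  multiplicities both count the diagonal entries (lemmas \<open>jordan_nf_projection\<close> and
  \<open>multiplicity_of_diagonalization\<close>).

  For the last property, the moment conditions of the quadrature are orthogonality relations: the inner
  products of \<open>s\<close>, \<open>A\<^sub>1 s\<close> and \<open>A\<^sub>2 s\<close> are exactly the moments of order 0, 1 and 2
  in the first two coordinates, so these three vectors are orthogonal, with squared norms
  \<open>1\<close>, \<open>D\<^sub>c\<close>, \<open>D\<^sub>c\<close>. Dividing the last two by \<open>a = sqrt D\<^sub>c\<close> gives \<open>E\<^sub>2\<close> and \<open>E\<^sub>3\<close>, and \<open>R\<close> fixes every
  vector orthogonal to \<open>s\<close>.
\<close>

section \<open>Outer products\<close>

lemma outer_prod_carrier [simp]: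
  "a \<in> carrier_vec n \<Longrightarrow> b \<in> carrier_vec m \<Longrightarrow> outer_prod a b \<in> carrier_mat n m"
  by (auto simp: outer_prod_def)

lemma outer_prod_dim [simp]:
  "dim_row (outer_prod a b) = dim_vec a" "dim_col (outer_prod a b) = dim_vec b"
  by (auto simp: outer_prod_def)

lemma outer_prod_index [simp]:
  "i < dim_vec a \<Longrightarrow> j < dim_vec b \<Longrightarrow> outer_prod a b $$ (i, j) = a $ i * b $ j"
  by (simp add: outer_prod_def)

lemma outer_prod_mult_vec:
  assumes "a \<in> carrier_vec n" "b \<in> carrier_vec m" "v \<in> carrier_vec m"
  shows "outer_prod a b *\<^sub>v v = (b \<bullet> v) \<cdot>\<^sub>v a"
  using assms
  by (intro eq_vecI) (auto simp: scalar_prod_def sum_distrib_left mult_ac)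

lemma mult_outer_prod:
  assumes "A \<in> carrier_mat k n" "a \<in> carrier_vec n" "b \<in> carrier_vec m"
  shows "A * outer_prod a b = outer_prod (A *\<^sub>v a) b"
  using assms
  by (intro eq_matI) (auto simp: scalar_prod_def sum_distrib_left mult_ac)

lemma outer_prod_mult:
  assumes "a \<in> carrier_vec k" "b \<in> carrier_vec n" "A \<in> carrier_mat n m"
  shows "outer_prod a b * A = outer_prod a (transpose_mat A *\<^sub>v b)"
  using assms
  by (intro eq_matI) (auto simp: scalar_prod_def sum_distrib_left mult_ac)

lemma one_minus_outer_prod_mult_vec:
  assumes "s \<in> carrier_vec n" "v \<in> carrier_vec n"
  shows "(1\<^sub>m n - c \<cdot>\<^sub>m outer_prod s s) *\<^sub>v v = v - (c * (s \<bullet> v)) \<cdot>\<^sub>v s"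
proof -
  have "(1\<^sub>m n - c \<cdot>\<^sub>m outer_prod s s) *\<^sub>v v = 1\<^sub>m n *\<^sub>v v - (c \<cdot>\<^sub>m outer_prod s s) *\<^sub>v v"
    using assms by (intro minus_mult_distrib_mat_vec[of _ n n]) auto
  also have "(c \<cdot>\<^sub>m outer_prod s s) *\<^sub>v v = c \<cdot>\<^sub>v (outer_prod s s *\<^sub>v v)"
    using assms by (intro eq_vecI) auto
  finally show ?thesis
    using assms by (simp add: outer_prod_mult_vec[of s n s n v] smult_smult_assoc)
qed

section \<open>Diagonalization of the projection by a reflection\<close>

definition householder :: "nat \<Rightarrow> real vec \<Rightarrow> real mat" where
  "householder n u = 1\<^sub>m n - (2 / (u \<bullet> u)) \<cdot>\<^sub>m outer_prod u u"

lemma householder_carrier [simp]: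
  "u \<in> carrier_vec n \<Longrightarrow> householder n u \<in> carrier_mat n n"
  by (auto simp: householder_def)

lemma transpose_householder:
  assumes "u \<in> carrier_vec n"
  shows "transpose_mat (householder n u) = householder n u"
  using assms unfolding householder_def by (intro eq_matI) (auto simp: mult.commute)

lemma householder_mult_vec:
  assumes "u \<in> carrier_vec n" "v \<in> carrier_vec n"
  shows "householder n u *\<^sub>v v = v - (2 / (u \<bullet> u) * (u \<bullet> v)) \<cdot>\<^sub>v u"
  unfolding householder_def using assms by (rule one_minus_outer_prod_mult_vec)

lemma householder_involution:
  assumes u: "u \<in> carrier_vec n" and nz: "u \<bullet> u \<noteq> 0"
  shows "householder n u * householder n u = 1\<^sub>m n"
proof -
  let ?c = "2 / (u \<bullet> u)" and ?H = "householder n u"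
  have Hu: "?H *\<^sub>v u = - u"
    unfolding householder_mult_vec[OF u u] using u nz by (intro eq_vecI) auto
  have "?H * ?H = ?H * 1\<^sub>m n - ?H * (?c \<cdot>\<^sub>m outer_prod u u)"
    unfolding householder_def
    using u by (intro mult_minus_distrib_mat[of _ n n _ n]) auto
  also have "?H * (?c \<cdot>\<^sub>m outer_prod u u) = ?c \<cdot>\<^sub>m outer_prod (- u) u"
    using u by (subst mult_smult_distrib[of _ n n _ n])
      (auto simp: mult_outer_prod[of _ n n _ _ n] Hu)
  also have "?H * 1\<^sub>m n - ?c \<cdot>\<^sub>m outer_prod (- u) u = 1\<^sub>m n"
    using u unfolding householder_def by (intro eq_matI) auto
  finally show ?thesis .
qed

text \<open>The vector \<open>u = e + s\<close> is normal to the bisecting hyperplane of \<open>e\<close> and \<open>- s\<close>. Sending \<open>e\<close> to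
  \<open>- s\<close> rather than to \<open>s\<close> avoids the degenerate case \<open>e = s\<close>, where the normal \<open>e - s\<close> would vanish;
  the sign does not show in the outer product.\<close>

lemma projections_similar:
  assumes s: "s \<in> carrier_vec n" and e: "e \<in> carrier_vec n"
    and ss: "s \<bullet> s = 1" and ee: "e \<bullet> e = 1" and es: "e \<bullet> s > -1"
  shows "similar_mat (1\<^sub>m n - outer_prod s s) (1\<^sub>m n - outer_prod e e)"
proof -
  define u where "u = e + s"
  let ?H = "householder n u"
  have u: "u \<in> carrier_vec n" using s e by (simp add: u_def)
  have H: "?H \<in> carrier_mat n n" using u by simp
  have se: "s \<bullet> e = e \<bullet> s" using s e by (rule comm_scalar_prod)
  have ue: "u \<bullet> e = 1 + e \<bullet> s"
    unfolding u_def using s e by (simp add: add_scalar_prod_distrib[of _ n] ee se)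
  have us: "u \<bullet> s = 1 + e \<bullet> s"
    unfolding u_def using s e by (simp add: add_scalar_prod_distrib[of _ n] ss)
  have "u \<bullet> u = u \<bullet> e + u \<bullet> s"
    using s e u unfolding u_def by (intro scalar_prod_add_distrib) auto
  then have uu: "u \<bullet> u = 2 * (1 + e \<bullet> s)" by (simp add: ue us)
  have coeff: "2 / (u \<bullet> u) * (u \<bullet> e) = 1"
    unfolding uu ue using es by (simp add: field_simps)
  have He: "?H *\<^sub>v e = - s"
    unfolding householder_mult_vec[OF u e] coeff
    using s e by (intro eq_vecI) (auto simp: u_def)
  have HH: "?H * ?H = 1\<^sub>m n"
    using u es by (intro householder_involution) (auto simp: uu)
  have "?H * (1\<^sub>m n - outer_prod e e) * ?H = (?H - outer_prod (- s) e) * ?H"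
    using H e by (simp add: mult_minus_distrib_mat[of _ n n _ n] mult_outer_prod[of _ n n _ _ n] He)
  also have "\<dots> = ?H * ?H - outer_prod (- s) e * ?H"
    using H s e by (intro minus_mult_distrib_mat[of _ n n]) auto
  also have "outer_prod (- s) e * ?H = outer_prod (- s) (- s)"
    using H s e by (simp add: outer_prod_mult[of _ n _ n _ n] transpose_householder[OF u] He)
  also have "?H * ?H - outer_prod (- s) (- s) = 1\<^sub>m n - outer_prod s s"
    using s unfolding HH by (intro eq_matI) auto
  finally have "similar_mat_wit (1\<^sub>m n - outer_prod s s) (1\<^sub>m n - outer_prod e e) ?H ?H"
    using H s e HH by (intro similar_mat_witI[of _ _ n]) auto
  then show ?thesis by (auto simp: similar_mat_def)
qed

lemma jordan_matrix_replicate_one: "jordan_matrix (replicate m (1, 1)) = (1\<^sub>m m :: real mat)"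
proof (induction m)
  case 0
  show ?case by (intro eq_matI) (auto simp: jordan_matrix_def)
next
  case (Suc m)
  have "jordan_block 1 1 = (1\<^sub>m 1 :: real mat)"
    by (rule eq_matI) auto
  moreover have "four_block_mat (1\<^sub>m 1) (0\<^sub>m 1 m) (0\<^sub>m m 1) (1\<^sub>m m) = (1\<^sub>m (Suc m) :: real mat)"
    by (rule eq_matI) auto
  ultimately show ?case
    using Suc.IH by (simp add: jordan_matrix_Cons sum_list_replicate del: One_nat_def)
qed

lemma jordan_matrix_unit_projection:
  "jordan_matrix ((1, 0) # replicate m (1, 1))
     = 1\<^sub>m (Suc m) - outer_prod (unit_vec (Suc m) 0) (unit_vec (Suc m) 0)"
  by (rule eq_matI)
    (auto simp: jordan_matrix_Cons jordan_matrix_replicate_one sum_list_replicate unit_vec_def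
      simp del: One_nat_def)

text \<open>The first coordinate of \<open>s\<close> is its inner product with \<open>e\<^sub>0\<close>. If it is nonnegative, \<open>s\<close> is not
  \<open>- e\<^sub>0\<close>, the one unit vector for which the normal of the reflection would vanish.\<close>

lemma jordan_nf_projection:
  assumes s: "s \<in> carrier_vec (Suc m)" and ss: "s \<bullet> s = 1" and pos: "s $ 0 \<ge> 0"
  shows "jordan_nf (1\<^sub>m (Suc m) - outer_prod s s) ((1, 0) # replicate m (1, 1))"
proof -
  let ?e = "unit_vec (Suc m) 0 :: real vec"
  have "?e \<bullet> s > -1"
    using s pos by (subst scalar_prod_left_unit[of _ "Suc m"]) auto
  then have "similar_mat (1\<^sub>m (Suc m) - outer_prod s s) (1\<^sub>m (Suc m) - outer_prod ?e ?e)"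
    using s ss by (intro projections_similar) auto
  then show ?thesis
    unfolding jordan_nf_def jordan_matrix_unit_projection by auto
qed

text \<open>The generalized eigenspaces of order 1 are the eigenspaces, and each block of size 1 adds one
  dimension to the eigenspace as well as one factor to the characteristic polynomial.\<close>

lemma multiplicity_of_diagonalization:
  fixes A :: "real mat"
  assumes A: "A \<in> carrier_mat n n" and jnf: "jordan_nf A (map (Pair 1) ks)" and k: "k \<in> set ks"
  shows "eigenvalue_multiplicity A k (count_list ks k)"
proof -
  have order: "Polynomial.order k (char_poly A) = count_list ks k"
    unfolding jordan_nf_order[OF jnf] by (induction ks) auto
  have "kernel_dim (char_matrix A k) = count_list ks k"
  proof -
    have "kernel_dim (char_matrix A k) = dim_gen_eigenspace A k 1"
      using A by (simp add: dim_gen_eigenspace_def)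
    also have "\<dots> = count_list ks k"
      unfolding dim_gen_eigenspace[OF jnf] by (induction ks) auto
    finally show ?thesis .
  qed
  moreover have "eigenvalue A k"
  proof -
    have "Polynomial.order k (char_poly A) \<noteq> 0" using order k by (simp add: count_list_0_iff)
    then have "poly (char_poly A) k = 0" by (simp add: order_root)
    then show ?thesis using eigenvalue_root_char_poly[OF A] by simp
  qed
  ultimately show ?thesis using order by (simp add: eigenvalue_multiplicity_def)
qed

section \<open>Equivalence of the two formulations\<close>

lemma mat_diag_mult_vec:
  assumes "v \<in> carrier_vec n" "i < n"
  shows "(mat_diag n g *\<^sub>v v) $ i = g i * (v $ i :: real)"
proof -
  have "(mat_diag n g *\<^sub>v v) $ i = (\<Sum>j\<in>{0..<n}. (if i = j then g j else 0) * v $ j)"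
    using assms by (simp add: mat_diag_def scalar_prod_def)
  also have "\<dots> = (\<Sum>j\<in>{0..<n}. if i = j then g j * v $ j else 0)"
    by (intro sum.cong) auto
  finally show ?thesis using assms(2) by simp
qed

lemma relax_mat_carrier [simp]: "w \<in> carrier_vec n \<Longrightarrow> relax_mat n w \<in> carrier_mat n n"
  unfolding relax_mat_def by (intro minus_carrier_mat) simp

lemma relax_mat_mult_vec:
  assumes "w \<in> carrier_vec n" "v \<in> carrier_vec n"
  shows "relax_mat n w *\<^sub>v v = v - (map_vec sqrt w \<bullet> v) \<cdot>\<^sub>v map_vec sqrt w"
proof -
  have "1 \<cdot>\<^sub>m M = M" for M :: "real mat" by (intro eq_matI) auto
  then show ?thesis
    using one_minus_outer_prod_mult_vec[of "map_vec sqrt w" n v 1] assms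
    by (simp add: relax_mat_def)
qed

lemma transport_row:
  fixes g h :: "nat \<Rightarrow> real"
  assumes i: "i < n"
    and V: "Ut \<in> carrier_vec n" "Ux \<in> carrier_vec n" "Uy \<in> carrier_vec n"
  shows "(Ut + (1 / \<epsilon>) \<cdot>\<^sub>v (mat_diag n g *\<^sub>v Ux) + (1 / \<epsilon>) \<cdot>\<^sub>v (mat_diag n h *\<^sub>v Uy)) $ i
       = Ut $ i + 1 / \<epsilon> * (g i * Ux $ i + h i * Uy $ i)"
proof -
  have "mat_diag n k *\<^sub>v v \<in> carrier_vec n" for k and v :: "real vec"
    by (intro carrier_vecI) (simp add: mat_diag_def)
  from this[of g Ux] this[of h Uy] show ?thesis
    using i V mat_diag_mult_vec[OF V(2) i, of g] mat_diag_mult_vec[OF V(3) i, of h]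
    by (simp add: carrier_matD[OF mat_diag_dim] distrib_left del: index_mult_mat_vec)
qed

lemma relaxation_row:
  fixes f :: "nat \<Rightarrow> real"
  assumes w: "w \<in> carrier_vec n" and pos: "\<forall>i<n. w $ i > 0" and i: "i < n"
  shows "(c \<cdot>\<^sub>v (relax_mat n w *\<^sub>v vec n (\<lambda>j. sqrt (w $ j) * f j))) $ i
       = c * (sqrt (w $ i) * (f i - (\<Sum>j<n. w $ j * f j)))"
proof -
  have "map_vec sqrt w \<bullet> vec n (\<lambda>j. sqrt (w $ j) * f j) = (\<Sum>j<n. w $ j * f j)"
    using w pos
    by (auto simp: scalar_prod_def lessThan_atLeast0 mult.assoc[symmetric] less_imp_le
        intro!: sum.cong)
  then show ?thesis
    using i w by (simp add: relax_mat_mult_vec algebra_simps)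
qed

lemma sn_solution_iff_system_solution:
  fixes Om :: "nat \<Rightarrow> real vec"
  assumes w: "w \<in> carrier_vec n" and pos: "\<forall>i<n. w $ i > 0"
  shows "sn_solution n Om w \<sigma> \<epsilon> D f \<longleftrightarrow>
    system_solution n (mat_diag n (\<lambda>i. Om i $ 0)) (mat_diag n (\<lambda>i. Om i $ 1)) (relax_mat n w) \<sigma> \<epsilon> D
      (\<lambda>t x y. vec n (\<lambda>j. sqrt (w $ j) * f j t x y))" (is "_ \<longleftrightarrow> ?sys")
proof
  let ?s = "\<lambda>i. sqrt (w $ i)" and ?U = "\<lambda>t x y. vec n (\<lambda>j. sqrt (w $ j) * f j t x y)"
  assume sn: "sn_solution n Om w \<sigma> \<epsilon> D f"
  show ?sys
    unfolding system_solution_def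
  proof (intro allI impI conjI)
    fix t x y assume "(t, x, y) \<in> D"
    then have "\<forall>i. \<exists>ft fx fy. i < n \<longrightarrow>
        ((\<lambda>s. f i s x y) has_real_derivative ft) (at t) \<and>
        ((\<lambda>s. f i t s y) has_real_derivative fx) (at x) \<and>
        ((\<lambda>s. f i t x s) has_real_derivative fy) (at y) \<and>
        ft + 1 / \<epsilon> * (Om i $ 0 * fx + Om i $ 1 * fy)
          = - (\<sigma> / \<epsilon>\<^sup>2) * (f i t x y - (\<Sum>j<n. w $ j * f j t x y))"
      using sn unfolding sn_solution_def by meson
    then obtain ft fx fy where sol: "\<forall>i. i < n \<longrightarrow>
        ((\<lambda>s. f i s x y) has_real_derivative ft i) (at t) \<and>
        ((\<lambda>s. f i t s y) has_real_derivative fx i) (at x) \<and>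
        ((\<lambda>s. f i t x s) has_real_derivative fy i) (at y) \<and>
        ft i + 1 / \<epsilon> * (Om i $ 0 * fx i + Om i $ 1 * fy i)
          = - (\<sigma> / \<epsilon>\<^sup>2) * (f i t x y - (\<Sum>j<n. w $ j * f j t x y))"
      unfolding choice_iff by blast
    then have eq: "ft i + 1 / \<epsilon> * (Om i $ 0 * fx i + Om i $ 1 * fy i)
          = - (\<sigma> / \<epsilon>\<^sup>2) * (f i t x y - (\<Sum>j<n. w $ j * f j t x y))" if "i < n" for i
      using that by blast
    let ?V = "\<lambda>g. vec n (\<lambda>i. ?s i * g i)"
    have "?V ft + (1 / \<epsilon>) \<cdot>\<^sub>v (mat_diag n (\<lambda>i. Om i $ 0) *\<^sub>v ?V fx)
            + (1 / \<epsilon>) \<cdot>\<^sub>v (mat_diag n (\<lambda>i. Om i $ 1) *\<^sub>v ?V fy)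
          = (- (\<sigma> / \<epsilon>\<^sup>2)) \<cdot>\<^sub>v (relax_mat n w *\<^sub>v ?U t x y)" (is "?L = ?R")
    proof (rule eq_vecI)
      show "dim_vec ?L = dim_vec ?R"
        using w by (simp add: mat_diag_def relax_mat_def)
      fix i assume "i < dim_vec ?R"
      then have i: "i < n" using w by (simp add: relax_mat_def)
      have "?L $ i = ?s i * (ft i + 1 / \<epsilon> * (Om i $ 0 * fx i + Om i $ 1 * fy i))"
        using i by (subst transport_row[OF i]) (auto simp: algebra_simps)
      also have "\<dots> = ?R $ i"
        unfolding eq[OF i] by (subst relaxation_row[OF w pos i]) auto
      finally show "?L $ i = ?R $ i" .
    qed
    moreover have "has_vec_deriv n (\<lambda>s. ?U s x y) (?V ft) t"
      "has_vec_deriv n (\<lambda>s. ?U t s y) (?V fx) x" "has_vec_deriv n (\<lambda>s. ?U t x s) (?V fy) y"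
      unfolding has_vec_deriv_def by (auto intro!: DERIV_cmult simp: sol)
    ultimately show "\<exists>Ut Ux Uy. has_vec_deriv n (\<lambda>s. ?U s x y) Ut t \<and>
        has_vec_deriv n (\<lambda>s. ?U t s y) Ux x \<and> has_vec_deriv n (\<lambda>s. ?U t x s) Uy y \<and>
        Ut + (1 / \<epsilon>) \<cdot>\<^sub>v (mat_diag n (\<lambda>i. Om i $ 0) *\<^sub>v Ux)
            + (1 / \<epsilon>) \<cdot>\<^sub>v (mat_diag n (\<lambda>i. Om i $ 1) *\<^sub>v Uy)
          = (- (\<sigma> / \<epsilon>\<^sup>2)) \<cdot>\<^sub>v (relax_mat n w *\<^sub>v ?U t x y)"
      by blast
  qed auto
next
  let ?s = "\<lambda>i. sqrt (w $ i)" and ?U = "\<lambda>t x y. vec n (\<lambda>j. sqrt (w $ j) * f j t x y)"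
  assume sys: ?sys
  show "sn_solution n Om w \<sigma> \<epsilon> D f"
    unfolding sn_solution_def
  proof (intro allI impI)
    fix t x y i assume txy: "(t, x, y) \<in> D" and i: "i < n"
    have s: "?s i > 0" using pos i by simp
    obtain Ut Ux Uy where
      der: "has_vec_deriv n (\<lambda>s. ?U s x y) Ut t" "has_vec_deriv n (\<lambda>s. ?U t s y) Ux x"
        "has_vec_deriv n (\<lambda>s. ?U t x s) Uy y"
      and eq: "Ut + (1 / \<epsilon>) \<cdot>\<^sub>v (mat_diag n (\<lambda>i. Om i $ 0) *\<^sub>v Ux)
            + (1 / \<epsilon>) \<cdot>\<^sub>v (mat_diag n (\<lambda>i. Om i $ 1) *\<^sub>v Uy)
          = (- (\<sigma> / \<epsilon>\<^sup>2)) \<cdot>\<^sub>v (relax_mat n w *\<^sub>v ?U t x y)"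
      using sys txy unfolding system_solution_def by meson
    have V: "Ut \<in> carrier_vec n" "Ux \<in> carrier_vec n" "Uy \<in> carrier_vec n"
      using der by (auto simp: has_vec_deriv_def)
    (* The derivatives of f i exist because f i is the component i of U divided by the constant ?s i. *)
    have unscale: "(g has_real_derivative d / ?s i) (at r)"
      if "((\<lambda>r. ?s i * g r) has_real_derivative d) (at r)" for g d r
      using DERIV_cdivide[OF that, of "?s i"] s by simp
    have row: "Ut $ i + 1 / \<epsilon> * (Om i $ 0 * Ux $ i + Om i $ 1 * Uy $ i)
        = - (\<sigma> / \<epsilon>\<^sup>2) * (?s i * (f i t x y - (\<Sum>j<n. w $ j * f j t x y)))"
      using arg_cong[OF eq, of "\<lambda>v. v $ i"]
      unfolding transport_row[OF i V] relaxation_row[OF w pos i] .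
    have "Ut $ i / ?s i + 1 / \<epsilon> * (Om i $ 0 * (Ux $ i / ?s i) + Om i $ 1 * (Uy $ i / ?s i))
        = (Ut $ i + 1 / \<epsilon> * (Om i $ 0 * Ux $ i + Om i $ 1 * Uy $ i)) / ?s i"
      by (simp add: add_divide_distrib distrib_left)
    also have "\<dots> = - (\<sigma> / \<epsilon>\<^sup>2) * (f i t x y - (\<Sum>j<n. w $ j * f j t x y))"
      unfolding row using s by simp
    finally show "\<exists>ft fx fy.
          ((\<lambda>s. f i s x y) has_real_derivative ft) (at t) \<and>
          ((\<lambda>s. f i t s y) has_real_derivative fx) (at x) \<and>
          ((\<lambda>s. f i t x s) has_real_derivative fy) (at y) \<and>
          ft + 1 / \<epsilon> * (Om i $ 0 * fx + Om i $ 1 * fy)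
            = - (\<sigma> / \<epsilon>\<^sup>2) * (f i t x y - (\<Sum>j<n. w $ j * f j t x y))"
      using der i unfolding has_vec_deriv_def
      by (intro exI[of _ "Ut $ i / ?s i"] exI[of _ "Ux $ i / ?s i"] exI[of _ "Uy $ i / ?s i"])
        (auto intro!: unscale)
  qed
qed

section \<open>Spectral properties of the system\<close>

lemma sn_quadrature_moments:
  assumes "sn_quadrature d n Om w" "k \<le> d" "l \<le> d"
  shows "(\<Sum>j<n. w $ j * Om j $ k) = 0"
    and "(\<Sum>j<n. w $ j * (Om j $ k * Om j $ l)) = (if k = l then diffusion_const d else 0)"
proof -
  note q = assms(1)[unfolded sn_quadrature_def]
  have "vec (d + 1) (\<lambda>k. \<Sum>j<n. w $ j * Om j $ k) $ k = 0\<^sub>v (d + 1) $ k" using q by simp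
  then show "(\<Sum>j<n. w $ j * Om j $ k) = 0" using assms(2) by simp
  have dim: "dim_vec (Om j) = d + 1" if "j < n" for j
    using q that by (auto simp: unit_sphere_def)
  have "mat (d + 1) (d + 1) (\<lambda>(k, l). \<Sum>j<n. w $ j * outer_prod (Om j) (Om j) $$ (k, l)) $$ (k, l)
      = (diffusion_const d \<cdot>\<^sub>m 1\<^sub>m (d + 1)) $$ (k, l)" using q by simp
  then have "(\<Sum>j<n. w $ j * outer_prod (Om j) (Om j) $$ (k, l))
      = (if k = l then diffusion_const d else 0)" using assms by auto
  moreover have "(\<Sum>j<n. w $ j * outer_prod (Om j) (Om j) $$ (k, l))
      = (\<Sum>j<n. w $ j * (Om j $ k * Om j $ l))"
    using assms dim by (intro sum.cong) auto
  ultimately show "(\<Sum>j<n. w $ j * (Om j $ k * Om j $ l)) = (if k = l then diffusion_const d else 0)"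
    by simp
qed

text \<open>Each of the two vectors carries one factor \<open>sqrt w\<close>. This is why the change of unknowns uses
  \<open>sqrt w\<close>: the weighted inner product of the quadrature becomes the Euclidean one, and orthonormality
  in the system is orthonormality with respect to the quadrature.\<close>

lemma scalar_prod_sqrt_weights:
  assumes nonneg: "\<forall>i<n. w $ i \<ge> 0"
  shows "vec n (\<lambda>j. sqrt (w $ j) * g j) \<bullet> vec n (\<lambda>j. sqrt (w $ j) * h j)
    = (\<Sum>j<n. w $ j * (g j * h j))"
proof -
  have "sqrt (w $ j) * g j * (sqrt (w $ j) * h j) = w $ j * (g j * h j)" if "j < n" for j
  proof -
    have "sqrt (w $ j) * g j * (sqrt (w $ j) * h j) = (sqrt (w $ j) * sqrt (w $ j)) * (g j * h j)"
      by (simp only: mult_ac)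
    then show ?thesis using nonneg that by simp
  qed
  then have "(\<Sum>j<n. sqrt (w $ j) * g j * (sqrt (w $ j) * h j)) = (\<Sum>j<n. w $ j * (g j * h j))"
    by (intro sum.cong) auto
  moreover have "vec n (\<lambda>j. sqrt (w $ j) * g j) \<bullet> vec n (\<lambda>j. sqrt (w $ j) * h j)
      = (\<Sum>j<n. sqrt (w $ j) * g j * (sqrt (w $ j) * h j))"
    by (simp add: scalar_prod_def lessThan_atLeast0)
  ultimately show ?thesis by simp
qed

lemma relax_mat_eigenvector_one:
  assumes w: "w \<in> carrier_vec n" and v: "v \<in> carrier_vec n"
    and unit: "v \<bullet> v = 1" and orth: "map_vec sqrt w \<bullet> v = 0"
  shows "eigenvector (relax_mat n w) v 1"
proof -
  have "v \<noteq> 0\<^sub>v n" using unit by auto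
  moreover have "relax_mat n w *\<^sub>v v = 1 \<cdot>\<^sub>v v"
    unfolding relax_mat_mult_vec[OF w v] orth using w v by (intro eq_vecI) auto
  ultimately show ?thesis using w v by (simp add: eigenvector_def relax_mat_def)
qed

lemma relax_mat_eigenvector_zero:
  assumes w: "w \<in> carrier_vec n" and unit: "map_vec sqrt w \<bullet> map_vec sqrt w = 1"
  shows "eigenvector (relax_mat n w) (map_vec sqrt w) 0"
proof -
  let ?s = "map_vec sqrt w"
  have s: "?s \<in> carrier_vec n" using w by simp
  have "?s \<noteq> 0\<^sub>v n"
  proof
    assume "?s = 0\<^sub>v n"
    then show False using unit by (metis scalar_prod_left_zero s zero_neq_one)
  qed
  moreover have "relax_mat n w *\<^sub>v ?s = 0 \<cdot>\<^sub>v ?s"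
    unfolding relax_mat_mult_vec[OF w s] unit using w by (intro eq_vecI) auto
  ultimately show ?thesis using w by (simp add: eigenvector_def relax_mat_def)
qed

text \<open>The case \<open>m = 0\<close> of a single direction is left out of the second claim because \<open>R\<close> is then the
  zero matrix and 1 is not an eigenvalue at all.\<close>

lemma relax_mat_multiplicities:
  assumes w: "w \<in> carrier_vec (Suc m)" and pos: "w $ 0 \<ge> 0"
    and unit: "map_vec sqrt w \<bullet> map_vec sqrt w = 1"
  shows "eigenvalue_multiplicity (relax_mat (Suc m) w) 0 1"
    and "m > 0 \<Longrightarrow> eigenvalue_multiplicity (relax_mat (Suc m) w) 1 m"
proof -
  let ?R = "relax_mat (Suc m) w"
  have R: "?R \<in> carrier_mat (Suc m) (Suc m)" using w by simp
  have "jordan_nf ?R ((1, 0) # replicate m (1, 1))"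
    unfolding relax_mat_def using w pos unit by (intro jordan_nf_projection) auto
  then have jnf: "jordan_nf ?R (map (Pair 1) (0 # replicate m 1))" by (simp add: map_replicate)
  have count: "count_list (replicate m (1 :: real)) k = (if k = 1 then m else 0)" for k
    by (induction m) auto
  show "eigenvalue_multiplicity ?R 0 1"
    using multiplicity_of_diagonalization[OF R jnf, of 0] by (simp add: count)
  show "eigenvalue_multiplicity ?R 1 m" if "m > 0"
    using multiplicity_of_diagonalization[OF R jnf, of 1] that by (simp add: count)
qed

theorem proposition6p1:
  fixes d n :: nat and Om :: "nat \<Rightarrow> real vec" and w :: "real vec" and \<sigma> \<epsilon> :: real
  assumes "d \<in> {1, 2}"
    and "sn_quadrature d n Om w"
    and "\<sigma> > 0"
    and "0 < \<epsilon>" and "\<epsilon> \<le> 1"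
  defines "R \<equiv> relax_mat n w"
    and "E1 \<equiv> map_vec sqrt w"
  shows "\<exists>A1 A2. A1 \<in> carrier_mat n n \<and> A2 \<in> carrier_mat n n \<and>
    (\<forall>D f. open D \<longrightarrow>
       (sn_solution n Om w \<sigma> \<epsilon> D f \<longleftrightarrow>
        system_solution n A1 A2 R \<sigma> \<epsilon> D
          (\<lambda>t x y. vec n (\<lambda>j. sqrt (w $ j) * f j t x y)))) \<and>
    kernel_dim R = 1 \<and>
    diagonal_mat A1 \<and> diagonal_mat A2 \<and>
    eigenvalue_multiplicity R 0 1 \<and> eigenvector R E1 0 \<and>
    eigenvalue_multiplicity R 1 (n - 1) \<and>
    transpose_mat R = R \<and>
    (\<exists>a E2 E3. A1 *\<^sub>v E1 = a \<cdot>\<^sub>v E2 \<and> A2 *\<^sub>v E1 = a \<cdot>\<^sub>v E3 \<and>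
       eigenvector R E2 1 \<and> eigenvector R E3 1 \<and>
       orthonormal_list [E1, E2, E3])"
proof -
  note q = assms(2)
  have w: "w \<in> carrier_vec n" and pos: "\<forall>i<n. w $ i > 0" and total: "(\<Sum>j<n. w $ j) = 1"
    using q by (auto simp: sn_quadrature_def)
  have nonneg: "\<forall>i<n. w $ i \<ge> 0" using pos less_imp_le by blast
  note inner = scalar_prod_sqrt_weights[OF nonneg]
  note moments = sn_quadrature_moments[OF q]
  have d: "0 \<le> d" "1 \<le> d" using assms(1) by auto
  define a where "a = sqrt (diffusion_const d)"
  have a: "a > 0" "a * a = diffusion_const d" "diffusion_const d \<noteq> 0"
    by (auto simp: a_def diffusion_const_def)
  define A1 A2 where "A1 = mat_diag n (\<lambda>i. Om i $ 0)" and "A2 = mat_diag n (\<lambda>i. Om i $ 1)"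
  define E where "E k = vec n (\<lambda>j. sqrt (w $ j) * (Om j $ k / a))" for k
  have E: "E k \<in> carrier_vec n" for k by (simp add: E_def)
  have E1: "E1 = vec n (\<lambda>j. sqrt (w $ j) * 1)" "E1 \<in> carrier_vec n"
    using w by (auto simp: E1_def)
  have E1E1: "E1 \<bullet> E1 = 1" unfolding E1(1) inner using total by simp
  have E1E: "E1 \<bullet> E k = 0" if "k \<le> d" for k
    unfolding E1(1) E_def inner using moments(1)[OF that that]
    by (simp add: sum_divide_distrib[symmetric])
  have EE: "E k \<bullet> E l = (if k = l then 1 else 0)" if "k \<le> d" "l \<le> d" for k l
  proof -
    have "E k \<bullet> E l = (\<Sum>j<n. w $ j * (Om j $ k * Om j $ l)) / (a * a)"
      unfolding E_def inner by (simp add: sum_divide_distrib)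
    then show ?thesis using moments(2)[OF that] a by simp
  qed
  have EE1: "E k \<bullet> E1 = 0" if "k \<le> d" for k
    using E1E[OF that] comm_scalar_prod[OF E E1(2)] by simp

  have evE: "eigenvector R (E k) 1" if "k \<le> d" for k
    unfolding R_def using w E E1E[OF that] EE[OF that that]
    by (intro relax_mat_eigenvector_one) (auto simp: E1_def)
  have evE1: "eigenvector R E1 0"
    unfolding R_def E1_def using w E1E1 by (intro relax_mat_eigenvector_zero) (auto simp: E1_def)

  obtain m where n: "n = Suc m" using total by (cases n) auto
  (* Dimension 1 has no room for the orthonormal pair E1, E 0. *)
  have "m > 0"
  proof (rule ccontr)
    assume "\<not> m > 0"
    then have "n = 1" using n by simp
    have "E1 $ 0 * E1 $ 0 = 1" "E1 $ 0 * E 0 $ 0 = 0" "E 0 $ 0 * E 0 $ 0 = 1"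
      using E1E1 E1E[OF d(1)] EE[OF d(1) d(1)] E1(2) E[of 0] \<open>n = 1\<close>
      by (auto simp: scalar_prod_def carrier_vecD)
    then show False by auto
  qed
  then have mult: "eigenvalue_multiplicity R 0 1" "eigenvalue_multiplicity R 1 (n - 1)"
    using relax_mat_multiplicities[of w m] w nonneg E1E1 by (auto simp: R_def E1_def n)
  have R: "R \<in> carrier_mat n n" using w by (simp add: R_def)
  have "char_matrix R 0 = R" using R unfolding char_matrix_def by (intro eq_matI) auto
  then have ker: "kernel_dim R = 1" using mult(1) by (simp add: eigenvalue_multiplicity_def)
  have sym: "transpose_mat R = R"
    using w unfolding R_def relax_mat_def by (intro eq_matI) (auto simp: mult.commute)

  have AE: "mat_diag n (\<lambda>i. Om i $ k) *\<^sub>v E1 = a \<cdot>\<^sub>v E k" for k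
  proof (rule eq_vecI)
    show "dim_vec (mat_diag n (\<lambda>i. Om i $ k) *\<^sub>v E1) = dim_vec (a \<cdot>\<^sub>v E k)"
      by (simp add: mat_diag_def E_def)
    fix i assume "i < dim_vec (a \<cdot>\<^sub>v E k)"
    then have i: "i < n" by (simp add: E_def)
    show "(mat_diag n (\<lambda>i. Om i $ k) *\<^sub>v E1) $ i = (a \<cdot>\<^sub>v E k) $ i"
      unfolding mat_diag_mult_vec[OF E1(2) i] using i a(1) by (simp add: E1(1) E_def)
  qed
  have orth: "orthonormal_list [E1, E 0, E 1]"
    using E1E1 E1E EE EE1 d by (auto simp: orthonormal_list_def less_Suc_eq numeral_3_eq_3)
  have last: "\<exists>a E2 E3. A1 *\<^sub>v E1 = a \<cdot>\<^sub>v E2 \<and> A2 *\<^sub>v E1 = a \<cdot>\<^sub>v E3 \<and>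
      eigenvector R E2 1 \<and> eigenvector R E3 1 \<and> orthonormal_list [E1, E2, E3]"
    unfolding A1_def A2_def using AE evE d orth by blast
  have diag: "diagonal_mat A1" "diagonal_mat A2" "A1 \<in> carrier_mat n n" "A2 \<in> carrier_mat n n"
    by (auto simp: A1_def A2_def diagonal_mat_def mat_diag_def)
  show ?thesis
    using sn_solution_iff_system_solution[OF w pos, of Om \<sigma> \<epsilon>, folded A1_def A2_def R_def]
      ker diag mult evE1 sym last
    by blast
qed

end
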